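(* Let $A$, $S_1$, $S_2$, $Y$ be random variables and suppose: (i) there exist random variables $(S_1(a),U_2(a),S_2(u_2),Y(s_1,s_2,u_2): a,s_1,s_2,u_2)$ with $S_1=S_1(A)$, $S_2=S_2(U_2)$, $Y=Y(S_1,S_2,U_2)$, where $U_2:=U_2(A)$; (ii) there is a random variable $U_1$ such that for all $a,s_1,s_2,u_2$: $(U_1,Y(s_1,s_2,u_2),S_1(a))\perp(U_2(a),S_2(u_2))$, $Y(s_1,s_2,u_2)\perp S_1(a)\mid U_1$, and $U_2(a)\perp S_2(u_2)$; (iii) $A\perp(U_1,U_2(a),S_1(a),S_2(u_2),Y(s_1,s_2,u_2): a,s_1,s_2,u_2)$. Then $(U_2,S_1)\perp S_2(u_2)$ for every $u_2$.
   Context: $\perp$ denotes statistical independence; $A$ is a randomized treatment (cell assignment), $S_1,S_2$ short-term metrics, $Y$ a long-term outcome, $U_1,U_2$ unobserved variables. *)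

theory Defs
  imports "HOL-Probability.Probability"
begin

definition gen_events :: "'o measure \<Rightarrow> 'b measure \<Rightarrow> ('o \<Rightarrow> 'b) \<Rightarrow> 'o set set" where
  "gen_events M N X = {X -` B \<inter> space M | B. B \<in> sets N}"

text \<open>Independence of two random variables with possibly different codomain types
  (the library's indep_var requires equal codomain types): the sigma-algebras generated
  by X and Y are independent.\<close>
definition indep_rv ::
  "'o measure \<Rightarrow> 'x measure \<Rightarrow> ('o \<Rightarrow> 'x) \<Rightarrow> 'y measure \<Rightarrow> ('o \<Rightarrow> 'y) \<Rightarrow> bool" where
  "indep_rv M MX X MY Y \<longleftrightarrow>
     X \<in> measurable M MX \<and> Y \<in> measurable M MY \<and>
     prob_space.indep_set M (gen_events M MX X) (gen_events M MY Y)"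

definition cond_indep_var ::
  "'o measure \<Rightarrow> 'x measure \<Rightarrow> ('o \<Rightarrow> 'x) \<Rightarrow> 'y measure \<Rightarrow> ('o \<Rightarrow> 'y)
     \<Rightarrow> 'z measure \<Rightarrow> ('o \<Rightarrow> 'z) \<Rightarrow> bool" where
  "cond_indep_var M MX X MY Y MZ Z \<longleftrightarrow>
     X \<in> measurable M MX \<and> Y \<in> measurable M MY \<and> Z \<in> measurable M MZ \<and>
     (\<forall>B\<in>sets MX. \<forall>C\<in>sets MY. AE \<omega> in M.
        real_cond_exp M (vimage_algebra (space M) Z MZ)
          (\<lambda>\<omega>. indicator B (X \<omega>) * indicator C (Y \<omega>)) \<omega>
      = real_cond_exp M (vimage_algebra (space M) Z MZ) (\<lambda>\<omega>. indicator B (X \<omega>)) \<omega>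
        * real_cond_exp M (vimage_algebra (space M) Z MZ) (\<lambda>\<omega>. indicator C (Y \<omega>)) \<omega>)"

end

theory Submission
  imports Defs
begin

text \<open>On the event \<open>A = a\<close> the pair \<open>(U2, S1)\<close> coincides with \<open>(U2(a), S1(a))\<close>, which is
  independent of \<open>S2(u2)\<close>: \<open>S1(a) \<perp> (U2(a), S2(u2))\<close> together with \<open>U2(a) \<perp> S2(u2)\<close> makes the joint
  law factor on rectangles. Since \<open>A\<close> is independent of all potential outcomes, summing these
  per-arm factorisations over the countably many values of \<open>A\<close> gives the claim.\<close>

lemma gen_events_eq_sigma_sets:
  assumes "X \<in> measurable M N" "sets N = sigma_sets (space N) G"
  shows "gen_events M N X = sigma_sets (space M) {X -` E \<inter> space M | E. E \<in> G}"
proof -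
  have "X \<in> space M \<rightarrow> space N" using measurable_space[OF assms(1)] by auto
  then show ?thesis unfolding gen_events_def assms(2) by (rule sigma_sets_vimage_commute)
qed

lemma gen_events_subset_sets:
  assumes "X \<in> measurable M N"
  shows "gen_events M N X \<subseteq> sets M"
  using assms unfolding gen_events_def by (auto intro: measurable_sets)

lemma gen_events_Pair_subset:
  assumes F: "sigma_algebra (space M) F"
    and f: "f \<in> measurable M N1" and g: "g \<in> measurable M N2"
    and f_F: "gen_events M N1 f \<subseteq> F" and g_F: "gen_events M N2 g \<subseteq> F"
  shows "gen_events M (N1 \<Otimes>\<^sub>M N2) (\<lambda>\<omega>. (f \<omega>, g \<omega>)) \<subseteq> F"
proof -
  interpret F: sigma_algebra "space M" F by (rule F)
  have fg: "(\<lambda>\<omega>. (f \<omega>, g \<omega>)) \<in> measurable M (N1 \<Otimes>\<^sub>M N2)"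
    using f g by (rule measurable_Pair)
  have "(\<lambda>\<omega>. (f \<omega>, g \<omega>)) -` (B \<times> C) \<inter> space M \<in> F"
    if "B \<in> sets N1" "C \<in> sets N2" for B C
  proof -
    have "f -` B \<inter> space M \<in> F" "g -` C \<inter> space M \<in> F"
      using that f_F g_F unfolding gen_events_def by blast+
    then have "(f -` B \<inter> space M) \<inter> (g -` C \<inter> space M) \<in> F"
      by (rule F.Int)
    moreover have "(\<lambda>\<omega>. (f \<omega>, g \<omega>)) -` (B \<times> C) \<inter> space M = (f -` B \<inter> space M) \<inter> (g -` C \<inter> space M)"
      by auto
    ultimately show ?thesis by simp
  qed
  then show ?thesis
    unfolding gen_events_eq_sigma_sets[OF fg sets_pair_measure[folded space_pair_measure]]
    by (intro F.sigma_sets_subset) blast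
qed

lemma indep_rv_cong:
  assumes "\<And>\<omega>. \<omega> \<in> space M \<Longrightarrow> X \<omega> = X' \<omega>"
  shows "indep_rv M MX X MY Y \<longleftrightarrow> indep_rv M MX X' MY Y"
proof -
  have "X -` B \<inter> space M = X' -` B \<inter> space M" for B
    using assms by auto
  then have "gen_events M MX X = gen_events M MX X'"
    unfolding gen_events_def by simp
  moreover have "X \<in> measurable M MX \<longleftrightarrow> X' \<in> measurable M MX"
    using assms by (rule measurable_cong)
  ultimately show ?thesis unfolding indep_rv_def by simp
qed

context prob_space
begin

lemma indep_rvD:
  assumes "indep_rv M MX X MY Y" "B \<in> sets MX" "C \<in> sets MY"
  shows "prob ((X -` B \<inter> space M) \<inter> (Y -` C \<inter> space M))
       = prob (X -` B \<inter> space M) * prob (Y -` C \<inter> space M)"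
proof -
  have "X -` B \<inter> space M \<in> gen_events M MX X" "Y -` C \<inter> space M \<in> gen_events M MY Y"
    using assms(2,3) unfolding gen_events_def by blast+
  with assms(1) show ?thesis unfolding indep_rv_def by (blast intro: indep_setD)
qed

lemma indep_rv_compose:
  assumes XY: "indep_rv M MX X MY Y"
    and f: "f \<in> measurable MX MX'" and g: "g \<in> measurable MY MY'"
  shows "indep_rv M MX' (\<lambda>\<omega>. f (X \<omega>)) MY' (\<lambda>\<omega>. g (Y \<omega>))"
proof -
  have X: "X \<in> measurable M MX" and Y: "Y \<in> measurable M MY"
    using XY unfolding indep_rv_def by auto
  have fX: "(\<lambda>\<omega>. f (X \<omega>)) \<in> measurable M MX'" and gY: "(\<lambda>\<omega>. g (Y \<omega>)) \<in> measurable M MY'"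
    using measurable_compose[OF X f] measurable_compose[OF Y g] .
  have "indep_set (gen_events M MX' (\<lambda>\<omega>. f (X \<omega>))) (gen_events M MY' (\<lambda>\<omega>. g (Y \<omega>)))"
  proof (rule indep_setI)
    show "gen_events M MX' (\<lambda>\<omega>. f (X \<omega>)) \<subseteq> events"
      using fX by (rule gen_events_subset_sets)
    show "gen_events M MY' (\<lambda>\<omega>. g (Y \<omega>)) \<subseteq> events"
      using gY by (rule gen_events_subset_sets)
  next
    fix E E' assume "E \<in> gen_events M MX' (\<lambda>\<omega>. f (X \<omega>))" "E' \<in> gen_events M MY' (\<lambda>\<omega>. g (Y \<omega>))"
    then obtain B C where "B \<in> sets MX'" "C \<in> sets MY'"
      and E: "E = X -` (f -` B \<inter> space MX) \<inter> space M"
      and E': "E' = Y -` (g -` C \<inter> space MY) \<inter> space M"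
      unfolding gen_events_def using measurable_space[OF X] measurable_space[OF Y] by blast
    then have "f -` B \<inter> space MX \<in> sets MX" "g -` C \<inter> space MY \<in> sets MY"
      using f g by (blast intro: measurable_sets)+
    with XY show "prob (E \<inter> E') = prob E * prob E'"
      unfolding E E' by (rule indep_rvD)
  qed
  with fX gY show ?thesis unfolding indep_rv_def by blast
qed

lemma indep_rv_Pair_rectanglesI:
  assumes X: "X \<in> measurable M (N1 \<Otimes>\<^sub>M N2)" and Y: "Y \<in> measurable M N"
    and rect: "\<And>B C D. B \<in> sets N1 \<Longrightarrow> C \<in> sets N2 \<Longrightarrow> D \<in> sets N \<Longrightarrow>
      prob ((X -` (B \<times> C) \<inter> space M) \<inter> (Y -` D \<inter> space M))
        = prob (X -` (B \<times> C) \<inter> space M) * prob (Y -` D \<inter> space M)"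
  shows "indep_rv M (N1 \<Otimes>\<^sub>M N2) X N Y"
proof -
  define R where "R = {X -` E \<inter> space M | E. E \<in> {B \<times> C | B C. B \<in> sets N1 \<and> C \<in> sets N2}}"
  have "indep_set R (gen_events M N Y)"
  proof (rule indep_setI)
    show "R \<subseteq> events" unfolding R_def using X by (auto intro: measurable_sets)
    show "gen_events M N Y \<subseteq> events" using Y by (rule gen_events_subset_sets)
    show "prob (E \<inter> E') = prob E * prob E'" if "E \<in> R" "E' \<in> gen_events M N Y" for E E'
      using that rect unfolding R_def gen_events_def by blast
  qed
  then have "indep_set (sigma_sets (space M) R) (sigma_sets (space M) (gen_events M N Y))"
  proof (rule indep_set_sigma_sets)
    show "Int_stable R" unfolding Int_stable_def R_def
    proof safe
      fix B C B' C' assume "B \<in> sets N1" "C \<in> sets N2" "B' \<in> sets N1" "C' \<in> sets N2"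
      then show "\<exists>E. (X -` (B \<times> C) \<inter> space M) \<inter> (X -` (B' \<times> C') \<inter> space M) = X -` E \<inter> space M
          \<and> E \<in> {B \<times> C | B C. B \<in> sets N1 \<and> C \<in> sets N2}"
        by (intro exI[of _ "(B \<inter> B') \<times> (C \<inter> C')"]) auto
    qed
    show "Int_stable (gen_events M N Y)" unfolding Int_stable_def gen_events_def
    proof safe
      fix D D' assume "D \<in> sets N" "D' \<in> sets N"
      then show "\<exists>E. (Y -` D \<inter> space M) \<inter> (Y -` D' \<inter> space M) = Y -` E \<inter> space M \<and> E \<in> sets N"
        by (intro exI[of _ "D \<inter> D'"]) auto
    qed
  qed
  moreover have "gen_events M (N1 \<Otimes>\<^sub>M N2) X = sigma_sets (space M) R"
    unfolding R_def by (rule gen_events_eq_sigma_sets[OF X sets_pair_measure[folded space_pair_measure]])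
  moreover have "sigma_sets (space M) (gen_events M N Y) = gen_events M N Y"
    using gen_events_eq_sigma_sets[OF Y sets.sigma_sets_eq[symmetric]]
    unfolding gen_events_def by simp
  ultimately show ?thesis using X Y unfolding indep_rv_def by simp
qed

lemma indep_rv_Pair_contraction:
  assumes XVT: "indep_rv M MX X (MV \<Otimes>\<^sub>M MT) (\<lambda>\<omega>. (V \<omega>, T \<omega>))"
    and VT: "indep_rv M MV V MT T"
  shows "indep_rv M (MV \<Otimes>\<^sub>M MX) (\<lambda>\<omega>. (V \<omega>, X \<omega>)) MT T"
proof (rule indep_rv_Pair_rectanglesI)
  have X: "X \<in> measurable M MX" using XVT unfolding indep_rv_def by blast
  have V: "V \<in> measurable M MV" and T: "T \<in> measurable M MT" using VT unfolding indep_rv_def by blast+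
  show "(\<lambda>\<omega>. (V \<omega>, X \<omega>)) \<in> measurable M (MV \<Otimes>\<^sub>M MX)" using V X by (rule measurable_Pair)
  show "T \<in> measurable M MT" by (rule T)
  fix B C D assume B: "B \<in> sets MV" and C: "C \<in> sets MX" and D: "D \<in> sets MT"
  let ?X = "X -` C \<inter> space M" and ?V = "V -` B \<inter> space M" and ?T = "T -` D \<inter> space M"
  have VT_BD: "(\<lambda>\<omega>. (V \<omega>, T \<omega>)) -` (B \<times> D) \<inter> space M = ?V \<inter> ?T"
    by auto
  have VT_B: "(\<lambda>\<omega>. (V \<omega>, T \<omega>)) -` (B \<times> space MT) \<inter> space M = ?V"
    using measurable_space[OF T] by auto
  have "(\<lambda>\<omega>. (V \<omega>, X \<omega>)) -` (B \<times> C) \<inter> space M \<inter> ?T = ?X \<inter> (?V \<inter> ?T)"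
    by auto
  also have "prob \<dots> = prob ?X * prob (?V \<inter> ?T)"
    using indep_rvD[OF XVT C, of "B \<times> D"] B D unfolding VT_BD by simp
  also have "\<dots> = prob ?X * prob ?V * prob ?T"
    using indep_rvD[OF VT B D] by simp
  also have "prob ?X * prob ?V = prob (?X \<inter> ?V)"
    using indep_rvD[OF XVT C, of "B \<times> space MT"] B unfolding VT_B by simp
  also have "?X \<inter> ?V = (\<lambda>\<omega>. (V \<omega>, X \<omega>)) -` (B \<times> C) \<inter> space M"
    by auto
  finally show "prob ((\<lambda>\<omega>. (V \<omega>, X \<omega>)) -` (B \<times> C) \<inter> space M \<inter> ?T)
      = prob ((\<lambda>\<omega>. (V \<omega>, X \<omega>)) -` (B \<times> C) \<inter> space M) * prob ?T" .
qed

lemma emeasure_UN_select: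
  fixes A :: "'a \<Rightarrow> 'i::countable"
  assumes A: "A \<in> measurable M (count_space UNIV)"
    and A_F: "indep_set (gen_events M (count_space UNIV) A) F"
    and Z: "\<And>i. Z i \<in> F"
  shows "emeasure M (\<Union>i. A -` {i} \<inter> space M \<inter> Z i)
       = (\<integral>\<^sup>+i. ennreal (prob (A -` {i} \<inter> space M) * prob (Z i)) \<partial>count_space UNIV)"
proof -
  have A_i: "A -` {i} \<inter> space M \<in> gen_events M (count_space UNIV) A" for i
    unfolding gen_events_def by auto
  have "A -` {i} \<inter> space M \<inter> Z i \<in> events" for i
    using indep_setD_ev1[OF A_F] indep_setD_ev2[OF A_F] A_i Z by blast
  moreover have "disjoint_family (\<lambda>i. A -` {i} \<inter> space M \<inter> Z i)"
    unfolding disjoint_family_on_def by auto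
  ultimately have "emeasure M (\<Union>i. A -` {i} \<inter> space M \<inter> Z i)
      = (\<integral>\<^sup>+i. emeasure M (A -` {i} \<inter> space M \<inter> Z i) \<partial>count_space UNIV)"
    by (intro emeasure_UN_countable) auto
  also have "\<dots> = (\<integral>\<^sup>+i. ennreal (prob (A -` {i} \<inter> space M) * prob (Z i)) \<partial>count_space UNIV)"
    using indep_setD[OF A_F A_i Z] by (simp add: emeasure_eq_measure)
  finally show ?thesis .
qed

lemma prob_UN_select_Int:
  fixes A :: "'a \<Rightarrow> 'i::countable"
  assumes A: "A \<in> measurable M (count_space UNIV)"
    and F: "sigma_algebra (space M) F"
    and A_F: "indep_set (gen_events M (count_space UNIV) A) F"
    and E: "\<And>i. E i \<in> F" and T: "T \<in> F"
    and E_T: "\<And>i. prob (E i \<inter> T) = prob (E i) * prob T"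
  shows "prob ((\<Union>i. A -` {i} \<inter> space M \<inter> E i) \<inter> T)
       = prob (\<Union>i. A -` {i} \<inter> space M \<inter> E i) * prob T"
proof -
  interpret F: sigma_algebra "space M" F by (rule F)
  have "E i \<inter> T \<in> F" for i
    using E T by (rule F.Int)
  moreover have "(\<Union>i. A -` {i} \<inter> space M \<inter> E i) \<inter> T = (\<Union>i. A -` {i} \<inter> space M \<inter> (E i \<inter> T))"
    by auto
  ultimately have "emeasure M ((\<Union>i. A -` {i} \<inter> space M \<inter> E i) \<inter> T)
      = (\<integral>\<^sup>+i. ennreal (prob (A -` {i} \<inter> space M) * prob (E i)) * ennreal (prob T) \<partial>count_space UNIV)"
    using E_T by (simp add: emeasure_UN_select[OF A A_F] ennreal_mult' mult.assoc)
  also have "\<dots> = emeasure M (\<Union>i. A -` {i} \<inter> space M \<inter> E i) * ennreal (prob T)"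
    by (simp add: nn_integral_multc emeasure_UN_select[OF A A_F E])
  finally show ?thesis
    by (simp add: emeasure_eq_measure ennreal_mult[symmetric])
qed

lemma indep_rv_select:
  fixes A :: "'a \<Rightarrow> 'i::countable" and X :: "'i \<Rightarrow> 'a \<Rightarrow> 'x"
  assumes A: "A \<in> measurable M (count_space UNIV)"
    and X_T: "\<And>i. indep_rv M MX (X i) MT T"
    and F: "sigma_algebra (space M) F"
    and A_F: "indep_set (gen_events M (count_space UNIV) A) F"
    and X_F: "\<And>i. gen_events M MX (X i) \<subseteq> F" and T_F: "gen_events M MT T \<subseteq> F"
  shows "indep_rv M MX (\<lambda>\<omega>. X (A \<omega>) \<omega>) MT T"
proof -
  have X: "X i \<in> measurable M MX" for i
    using X_T unfolding indep_rv_def by blast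
  have T: "T \<in> measurable M MT"
    using X_T unfolding indep_rv_def by blast
  have XA: "(\<lambda>\<omega>. X (A \<omega>) \<omega>) \<in> measurable M MX"
    by (rule measurable_compose_countable'[where I=UNIV]) (auto intro: X A)
  have "indep_set (gen_events M MX (\<lambda>\<omega>. X (A \<omega>) \<omega>)) (gen_events M MT T)"
  proof (rule indep_setI)
    show "gen_events M MX (\<lambda>\<omega>. X (A \<omega>) \<omega>) \<subseteq> events" using XA by (rule gen_events_subset_sets)
    show "gen_events M MT T \<subseteq> events" using T by (rule gen_events_subset_sets)
  next
    fix E E' assume "E \<in> gen_events M MX (\<lambda>\<omega>. X (A \<omega>) \<omega>)" "E' \<in> gen_events M MT T"
    then obtain B D where B: "B \<in> sets MX" and D: "D \<in> sets MT"
      and E: "E = (\<lambda>\<omega>. X (A \<omega>) \<omega>) -` B \<inter> space M" and E': "E' = T -` D \<inter> space M"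
      unfolding gen_events_def by blast
    have "E = (\<Union>i. A -` {i} \<inter> space M \<inter> (X i -` B \<inter> space M))"
      unfolding E by auto
    moreover have "X i -` B \<inter> space M \<in> F" for i
      using X_F B unfolding gen_events_def by blast
    moreover have "E' \<in> F"
      using T_F D unfolding E' gen_events_def by blast
    ultimately show "prob (E \<inter> E') = prob E * prob E'"
      using prob_UN_select_Int[OF A F A_F] indep_rvD[OF X_T B D] unfolding E' by simp
  qed
  with XA T show ?thesis unfolding indep_rv_def by blast
qed

end

theorem lemma1:
  fixes M :: "'o measure"
    and MS1 :: "'s1 measure" and MS2 :: "'s2 measure" and MU2 :: "'u2 measure"
    and MY :: "'y measure" and MU1 :: "'u1 measure"
    and A :: "'o \<Rightarrow> 'a::countable"
    and S1o :: "'o \<Rightarrow> 's1" and S2o :: "'o \<Rightarrow> 's2" and Yo :: "'o \<Rightarrow> 'y"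
    and S1 :: "'a \<Rightarrow> 'o \<Rightarrow> 's1" and U2 :: "'a \<Rightarrow> 'o \<Rightarrow> 'u2"
    and S2 :: "'u2 \<Rightarrow> 'o \<Rightarrow> 's2" and Y :: "'s1 \<Rightarrow> 's2 \<Rightarrow> 'u2 \<Rightarrow> 'o \<Rightarrow> 'y"
    and U1 :: "'o \<Rightarrow> 'u1"
  assumes M: "prob_space M"
    \<comment> \<open>observed random variables\<close>
    and rvA: "A \<in> measurable M (count_space UNIV)"
    and rvS1o: "S1o \<in> measurable M MS1"
    and rvS2o: "S2o \<in> measurable M MS2"
    and rvYo: "Yo \<in> measurable M MY"
    \<comment> \<open>(i) potential outcomes are random variables, and consistency\<close>
    and rvS1: "\<And>a. S1 a \<in> measurable M MS1"
    and rvU2: "\<And>a. U2 a \<in> measurable M MU2"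
    and rvS2: "\<And>u2. u2 \<in> space MU2 \<Longrightarrow> S2 u2 \<in> measurable M MS2"
    and rvY: "\<And>s1 s2 u2. s1 \<in> space MS1 \<Longrightarrow> s2 \<in> space MS2 \<Longrightarrow> u2 \<in> space MU2
                \<Longrightarrow> Y s1 s2 u2 \<in> measurable M MY"
    and consS1: "\<And>\<omega>. \<omega> \<in> space M \<Longrightarrow> S1o \<omega> = S1 (A \<omega>) \<omega>"
    and consS2: "\<And>\<omega>. \<omega> \<in> space M \<Longrightarrow> S2o \<omega> = S2 (U2 (A \<omega>) \<omega>) \<omega>"
    and consY: "\<And>\<omega>. \<omega> \<in> space M \<Longrightarrow> Yo \<omega> = Y (S1o \<omega>) (S2o \<omega>) (U2 (A \<omega>) \<omega>) \<omega>"
    \<comment> \<open>(ii)\<close>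
    and rvU1: "U1 \<in> measurable M MU1"
    and ii1: "\<And>a s1 s2 u2. s1 \<in> space MS1 \<Longrightarrow> s2 \<in> space MS2 \<Longrightarrow> u2 \<in> space MU2 \<Longrightarrow>
       indep_rv M
         (MU1 \<Otimes>\<^sub>M (MY \<Otimes>\<^sub>M MS1)) (\<lambda>\<omega>. (U1 \<omega>, Y s1 s2 u2 \<omega>, S1 a \<omega>))
         (MU2 \<Otimes>\<^sub>M MS2) (\<lambda>\<omega>. (U2 a \<omega>, S2 u2 \<omega>))"
    and ii2: "\<And>a s1 s2 u2. s1 \<in> space MS1 \<Longrightarrow> s2 \<in> space MS2 \<Longrightarrow> u2 \<in> space MU2 \<Longrightarrow>
       cond_indep_var M MY (Y s1 s2 u2) MS1 (S1 a) MU1 U1"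
    and ii3: "\<And>a u2. u2 \<in> space MU2 \<Longrightarrow>
       indep_rv M MU2 (U2 a) MS2 (S2 u2)"
    \<comment> \<open>(iii) A is independent of the sigma-algebra generated by the whole family\<close>
    and iii: "prob_space.indep_set M (gen_events M (count_space UNIV) A)
       (sigma_sets (space M)
          (gen_events M MU1 U1
           \<union> (\<Union>a. gen_events M MU2 (U2 a))
           \<union> (\<Union>a. gen_events M MS1 (S1 a))
           \<union> (\<Union>u2\<in>space MU2. gen_events M MS2 (S2 u2))
           \<union> (\<Union>s1\<in>space MS1. \<Union>s2\<in>space MS2. \<Union>u2\<in>space MU2.
                 gen_events M MY (Y s1 s2 u2))))"
  shows "\<forall>u2\<in>space MU2.
     indep_rv M (MU2 \<Otimes>\<^sub>M MS1) (\<lambda>\<omega>. (U2 (A \<omega>) \<omega>, S1o \<omega>)) MS2 (S2 u2)"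
proof
  fix u2 assume u2: "u2 \<in> space MU2"
  interpret prob_space M by (rule M)
  define F where "F = sigma_sets (space M)
          (gen_events M MU1 U1
           \<union> (\<Union>a. gen_events M MU2 (U2 a))
           \<union> (\<Union>a. gen_events M MS1 (S1 a))
           \<union> (\<Union>u2\<in>space MU2. gen_events M MS2 (S2 u2))
           \<union> (\<Union>s1\<in>space MS1. \<Union>s2\<in>space MS2. \<Union>u2\<in>space MU2.
                 gen_events M MY (Y s1 s2 u2)))"
  have F: "sigma_algebra (space M) F"
    unfolding F_def by (rule sigma_algebra_sigma_sets) (auto simp: gen_events_def)
  have U2S1_F: "gen_events M (MU2 \<Otimes>\<^sub>M MS1) (\<lambda>\<omega>. (U2 a \<omega>, S1 a \<omega>)) \<subseteq> F" for a
    using F rvU2 rvS1 by (rule gen_events_Pair_subset) (auto simp: F_def)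
  have S2_F: "gen_events M MS2 (S2 u2) \<subseteq> F"
    using u2 by (auto simp: F_def)
  \<comment> \<open>(ii) is assumed only at values inside the spaces; a sample point supplies some, and the
    \<open>Y\<close>-component they affect is discarded anyway\<close>
  obtain \<omega> where \<omega>: "\<omega> \<in> space M" using not_empty by blast
  have s1: "S1 a \<omega> \<in> space MS1" for a using rvS1 \<omega> by (rule measurable_space)
  have s2: "S2 u2 \<omega> \<in> space MS2" using rvS2[OF u2] \<omega> by (rule measurable_space)
  have arm: "indep_rv M (MU2 \<Otimes>\<^sub>M MS1) (\<lambda>\<omega>. (U2 a \<omega>, S1 a \<omega>)) MS2 (S2 u2)" for a
  proof (rule indep_rv_Pair_contraction)
    show "indep_rv M MS1 (S1 a) (MU2 \<Otimes>\<^sub>M MS2) (\<lambda>\<omega>. (U2 a \<omega>, S2 u2 \<omega>))"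
      using indep_rv_compose[OF ii1[OF s1 s2 u2], of "\<lambda>x. snd (snd x)" MS1 "\<lambda>x. x"] by simp
    show "indep_rv M MU2 (U2 a) MS2 (S2 u2)" using u2 by (rule ii3)
  qed
  have "indep_rv M (MU2 \<Otimes>\<^sub>M MS1) (\<lambda>\<omega>. (U2 (A \<omega>) \<omega>, S1 (A \<omega>) \<omega>)) MS2 (S2 u2)"
    using indep_rv_select[OF rvA arm F iii[folded F_def] U2S1_F S2_F] .
  then show "indep_rv M (MU2 \<Otimes>\<^sub>M MS1) (\<lambda>\<omega>. (U2 (A \<omega>) \<omega>, S1o \<omega>)) MS2 (S2 u2)"
    by (subst indep_rv_cong) (auto simp: consS1)
qed

end
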